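(* Let $0\le i<n$ and let $M_i,\dots,M_n$ be Event-B machines such that $M_i \preccurlyeq_W \cdots \preccurlyeq_W M_n$ is a refinement chain obeying the development strategy described in the context, in which no event is renamed or split (so that $\alpha M_{k}\subseteq\alpha M_{k+1}$, and an event of $M_{k+1}$ refines an event of $M_k$ exactly when it is that same event). Let $\phi$ be an LTL formula and $\beta$ a set of events. If $M_i\models\phi$, $M_n$ is deadlock free, $M_n$ does not contain any anticipated events, $\phi$ is $\beta$-dependent, and $\beta\subseteq\alpha M_i$, then $M_n\models\phi$.
   Context: Fix an infinite set $\Sigma$ of event names. **Machines.** An Event-B machine $M$ has a set of states (values $v$ of its variables), an invariant $I(v)$, a non-empty set of initial states, and a finite set $\alpha M\subseteq\Sigma$ of events (its alphabet; initialisation is not in it). Each event $e$ has a guard $G_e(x,v)$ and a before-after predicate $BA_e(v,x,v')$, where $x$ are the (optional) parameters. Event $e$ is enabled in $v$ if $\exists x.\,G_e(x,v)$; write $v\xrightarrow{e}v'$ if $\exists x.\,G_e(x,v)\wedge BA_e(v,x,v')$. All initial states satisfy $I$, and $I(v)$ and $v\xrightarrow{e}v'$ imply $I(v')$. Events are feasible: if $I(v)$ holds and $e$ is enabled in $v$ then $v\xrightarrow{e}v'$ for some $v'$. $M$ is deadlock free if in every state satisfying $I$ at least one event is enabled. Every event carries exactly one label: ordinary, anticipated or convergent. **Traces.** A trace of $M$ is a maximal execution: either an infinite sequence $\langle e_0,e_1,\dots\rangle$ of events such that $v_0\xrightarrow{e_0}v_1\xrightarrow{e_1}\cdots$ for some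 states with $v_0$ initial, or a finite sequence $\langle e_0,\dots,e_{k-1}\rangle$ with $v_0\xrightarrow{e_0}\cdots\xrightarrow{e_{k-1}}v_k$, $v_0$ initial, and no event enabled in $v_k$. **Refinement.** Let $M$ (states $v$, invariant $I$) and $M'$ (states $w$, invariant $I'$) be machines, with a specification of which events of $M'$ refine which events of $M$ (each event of $M'$ refines at most one event of $M$; an event refining none is called new). $M\preccurlyeq_W M'$ means there are a linking invariant $J(v,w)$ and a natural-number-valued variant $V(w)$ such that: every initial $w$ has an initial $v$ with $J(v,w)$; and for all $v,w$ with $I(v), I'(w), J(v,w)$ and all $e'\in\alpha M'$: (feasibility) if $e'$ is enabled in $w$ then $w\xrightarrow{e'}w'$ for some $w'$; (guard strengthening) if $e'$ refines $e$ and $e'$ is enabled in $w$ then $e$ is enabled in $v$; (simulation) if $w\xrightarrow{e'}w'$ and $e'$ refines $e$ then there is $v'$ with $v\xrightarrow{e}v'$ and $J(v',w')$, while if $w\xrightarrow{e'}w'$ and $e'$ is new then $J(v,w')$; (variant) if $w\xrightarrow{e'}w'$ then $V(w')<V(w)$ when $e'$ is convergent and $V(w')\le V(w)$ when $e'$ is anticipated. **Development strategy** for the chain: all events of the machine with index $0$ (if it is in the chain) are ordinary; and for each pair of consecutive machines $M_k\preccurlyeq_W M_{k+1}$: each event of $M_k$ is refined by at least one event of $M_{k+1}$; each new event of $M_{k+1}$ is anticipated or convergent; each event of $M_{k+1}$ refining an anticipated event of $M_k$ is anticipated or convergent; each event of $M_{k+1}$ refining a convergent or ordinary event of $M_k$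 is ordinary. **LTL.** Formulae: $\phi::=true\mid[x]\mid\neg\phi\mid\phi\vee\phi\mid\phi\,U\,\phi$ with $x\in\Sigma$ ($\wedge$, $F$, $G$ are derived as usual). For a finite or infinite sequence $u$ of events, $u^k$ denotes $u$ with its first $k$ elements removed ($k$ ranges over indices not exceeding the length of $u$). $u\models true$ always; $u\models[x]$ iff $u$ is non-empty with first element $x$; $\neg,\vee$ as usual; $u\models\phi_1U\phi_2$ iff there is $k\ge0$ with $u^k\models\phi_2$ and $u^i\models\phi_1$ for all $i<k$. $M\models\phi$ iff every trace of $M$ satisfies $\phi$. The alphabet $\alpha(\phi)$ is the set of events $x$ such that $[x]$ occurs in $\phi$. **$\beta$-dependence.** For a sequence $u$ and a set $\beta\subseteq\Sigma$, $u\upharpoonright\beta$ is the (finite or infinite) subsequence of $u$ consisting of the elements in $\beta$. $\phi$ is $\beta$-dependent if $\alpha(\phi)\subseteq\beta$ and, for all finite or infinite sequences $u$ over $\Sigma$, $u\models\phi\Leftrightarrow(u\upharpoonright\beta)\models\phi$. *)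

theory Defs
  imports Main "HOL-Library.Extended_Nat" "HOL-Library.Infinite_Set"
begin

datatype event_label = Ordinary | Anticipated | Convergent

text \<open>
  The type \<open>'e\<close> plays the role of the set of all event names. The machines of a refinement chain
  share the types \<open>'s\<close> and \<open>'p\<close> of states and parameters, but each has its own state space
  \<open>states M\<close>, so different state spaces can be accommodated in one (sum) type. Restrictions on
  the values of parameters are part of the guard; an event without parameters has a guard and a
  before-after predicate that ignore the parameter.
\<close>

record ('e, 's, 'p) machine =
  states :: "'s set"
  invariant :: "'s \<Rightarrow> bool"
  initial :: "'s set"
  alphabet :: "'e set"
  guard :: "'e \<Rightarrow> 'p \<Rightarrow> 's \<Rightarrow> bool"
  before_after :: "'e \<Rightarrow> 's \<Rightarrow> 'p \<Rightarrow> 's \<Rightarrow> bool"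
  label :: "'e \<Rightarrow> event_label"

definition enabled :: "('e, 's, 'p) machine \<Rightarrow> 'e \<Rightarrow> 's \<Rightarrow> bool" where
  "enabled M e v \<longleftrightarrow> e \<in> alphabet M \<and> v \<in> states M \<and> (\<exists>x. guard M e x v)"

definition step :: "('e, 's, 'p) machine \<Rightarrow> 's \<Rightarrow> 'e \<Rightarrow> 's \<Rightarrow> bool" where
  "step M v e v' \<longleftrightarrow> e \<in> alphabet M \<and> v \<in> states M \<and> v' \<in> states M \<and>
     (\<exists>x. guard M e x v \<and> before_after M e v x v')"

definition event_b_machine :: "('e, 's, 'p) machine \<Rightarrow> bool" where
  "event_b_machine M \<longleftrightarrow>
     finite (alphabet M) \<and>
     initial M \<noteq> {} \<and> initial M \<subseteq> states M \<and>
     (\<forall>v\<in>initial M. invariant M v) \<and>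
     (\<forall>v e v'. invariant M v \<and> step M v e v' \<longrightarrow> invariant M v') \<and>
     (\<forall>v\<in>states M. \<forall>e\<in>alphabet M.
        invariant M v \<and> enabled M e v \<longrightarrow> (\<exists>v'. step M v e v'))"

definition deadlock_free :: "('e, 's, 'p) machine \<Rightarrow> bool" where
  "deadlock_free M \<longleftrightarrow> (\<forall>v\<in>states M. invariant M v \<longrightarrow> (\<exists>e\<in>alphabet M. enabled M e v))"

datatype 'e seq = Fin "'e list" | Inf "nat \<Rightarrow> 'e"

fun seq_length :: "'e seq \<Rightarrow> enat" where
  "seq_length (Fin es) = enat (length es)"
| "seq_length (Inf s) = \<infinity>"

fun seq_drop :: "nat \<Rightarrow> 'e seq \<Rightarrow> 'e seq" where
  "seq_drop k (Fin es) = Fin (drop k es)"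
| "seq_drop k (Inf s) = Inf (\<lambda>j. s (k + j))"

fun starts_with :: "'e seq \<Rightarrow> 'e \<Rightarrow> bool" where
  "starts_with (Fin es) x \<longleftrightarrow> es \<noteq> [] \<and> hd es = x"
| "starts_with (Inf s) x \<longleftrightarrow> s 0 = x"

text \<open>
  For an infinite sequence, the restriction lists the elements at the positions in \<open>A\<close>
  (those holding an element of \<open>\<beta>\<close>) in increasing order of position.
\<close>

fun seq_restrict :: "'e seq \<Rightarrow> 'e set \<Rightarrow> 'e seq" where
  "seq_restrict (Fin es) \<beta> = Fin (filter (\<lambda>x. x \<in> \<beta>) es)"
| "seq_restrict (Inf s) \<beta> =
     (let A = {k. s k \<in> \<beta>} in
      if finite A then Fin (map s (sorted_list_of_set A)) else Inf (\<lambda>j. s (enumerate A j)))"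

fun is_trace :: "('e, 's, 'p) machine \<Rightarrow> 'e seq \<Rightarrow> bool" where
  "is_trace M (Fin es) \<longleftrightarrow>
     (\<exists>v. v 0 \<in> initial M \<and>
          (\<forall>k<length es. step M (v k) (es ! k) (v (Suc k))) \<and>
          (\<forall>e\<in>alphabet M. \<not> enabled M e (v (length es))))"
| "is_trace M (Inf s) \<longleftrightarrow>
     (\<exists>v. v 0 \<in> initial M \<and> (\<forall>k. step M (v k) (s k) (v (Suc k))))"

text \<open>
  The partial function \<open>r\<close> specifies which events are refined: \<open>r e' = Some e\<close> means that \<open>e'\<close>
  refines \<open>e\<close>, and \<open>r e' = None\<close> that \<open>e'\<close> is new.
\<close>

definition refinement_with ::
  "('e, 's, 'p) machine \<Rightarrow> ('e \<rightharpoonup> 'e) \<Rightarrow> ('e, 't, 'q) machine \<Rightarrow>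
   ('s \<Rightarrow> 't \<Rightarrow> bool) \<Rightarrow> ('t \<Rightarrow> nat) \<Rightarrow> bool" where
  "refinement_with M r M' J V \<longleftrightarrow>
     (\<forall>w\<in>initial M'. \<exists>v\<in>initial M. J v w) \<and>
     (\<forall>v\<in>states M. \<forall>w\<in>states M'. \<forall>e'\<in>alphabet M'.
        invariant M v \<and> invariant M' w \<and> J v w \<longrightarrow>
          (enabled M' e' w \<longrightarrow> (\<exists>w'. step M' w e' w')) \<and>
          (\<forall>e. r e' = Some e \<and> enabled M' e' w \<longrightarrow> enabled M e v) \<and>
          (\<forall>w' e. step M' w e' w' \<and> r e' = Some e \<longrightarrow> (\<exists>v'. step M v e v' \<and> J v' w')) \<and>
          (\<forall>w'. step M' w e' w' \<and> r e' = None \<longrightarrow> J v w') \<and>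
          (\<forall>w'. step M' w e' w' \<and> label M' e' = Convergent \<longrightarrow> V w' < V w) \<and>
          (\<forall>w'. step M' w e' w' \<and> label M' e' = Anticipated \<longrightarrow> V w' \<le> V w))"

definition refines_W ::
  "('e, 's, 'p) machine \<Rightarrow> ('e \<rightharpoonup> 'e) \<Rightarrow> ('e, 't, 'q) machine \<Rightarrow> bool" where
  "refines_W M r M' \<longleftrightarrow>
     (\<forall>e'\<in>alphabet M'. \<forall>e. r e' = Some e \<longrightarrow> e \<in> alphabet M) \<and>
     (\<exists>J V. refinement_with M r M' J V)"

definition strategy_step ::
  "('e, 's, 'p) machine \<Rightarrow> ('e \<rightharpoonup> 'e) \<Rightarrow> ('e, 't, 'q) machine \<Rightarrow> bool" where
  "strategy_step M r M' \<longleftrightarrow>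
     (\<forall>e\<in>alphabet M. \<exists>e'\<in>alphabet M'. r e' = Some e) \<and>
     (\<forall>e'\<in>alphabet M'. r e' = None \<longrightarrow> label M' e' \<in> {Anticipated, Convergent}) \<and>
     (\<forall>e'\<in>alphabet M'. \<forall>e. r e' = Some e \<and> label M e = Anticipated \<longrightarrow>
        label M' e' \<in> {Anticipated, Convergent}) \<and>
     (\<forall>e'\<in>alphabet M'. \<forall>e. r e' = Some e \<and> label M e \<in> {Convergent, Ordinary} \<longrightarrow>
        label M' e' = Ordinary)"

text \<open>A chain \<open>M i, \<dots>, M n\<close>, where \<open>r k\<close> specifies how \<open>M (Suc k)\<close> refines \<open>M k\<close>.\<close>

definition refinement_chain ::
  "nat \<Rightarrow> nat \<Rightarrow> (nat \<Rightarrow> ('e, 's, 'p) machine) \<Rightarrow> (nat \<Rightarrow> 'e \<rightharpoonup> 'e) \<Rightarrow> bool" where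
  "refinement_chain i n M r \<longleftrightarrow> (\<forall>k\<in>{i..<n}. refines_W (M k) (r k) (M (Suc k)))"

definition development_strategy ::
  "nat \<Rightarrow> nat \<Rightarrow> (nat \<Rightarrow> ('e, 's, 'p) machine) \<Rightarrow> (nat \<Rightarrow> 'e \<rightharpoonup> 'e) \<Rightarrow> bool" where
  "development_strategy i n M r \<longleftrightarrow>
     (i = 0 \<longrightarrow> (\<forall>e\<in>alphabet (M 0). label (M 0) e = Ordinary)) \<and>
     (\<forall>k\<in>{i..<n}. strategy_step (M k) (r k) (M (Suc k)))"

definition no_renaming_or_splitting ::
  "nat \<Rightarrow> nat \<Rightarrow> (nat \<Rightarrow> ('e, 's, 'p) machine) \<Rightarrow> (nat \<Rightarrow> 'e \<rightharpoonup> 'e) \<Rightarrow> bool" where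
  "no_renaming_or_splitting i n M r \<longleftrightarrow>
     (\<forall>k\<in>{i..<n}.
        alphabet (M k) \<subseteq> alphabet (M (Suc k)) \<and>
        (\<forall>e'\<in>alphabet (M (Suc k)). \<forall>e\<in>alphabet (M k). r k e' = Some e \<longleftrightarrow> e' = e))"

datatype (ltl_alphabet: 'e) ltl =
    LTrue
  | Atom 'e
  | Neg "'e ltl"
  | Or "'e ltl" "'e ltl"
  | Until "'e ltl" "'e ltl"

primrec sat :: "'e ltl \<Rightarrow> 'e seq \<Rightarrow> bool" where
  "sat LTrue u \<longleftrightarrow> True"
| "sat (Atom x) u \<longleftrightarrow> starts_with u x"
| "sat (Neg \<phi>) u \<longleftrightarrow> \<not> sat \<phi> u"
| "sat (Or \<phi> \<psi>) u \<longleftrightarrow> sat \<phi> u \<or> sat \<psi> u"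
| "sat (Until \<phi> \<psi>) u \<longleftrightarrow>
     (\<exists>k. enat k \<le> seq_length u \<and> sat \<psi> (seq_drop k u) \<and> (\<forall>i<k. sat \<phi> (seq_drop i u)))"

definition satisfies :: "('e, 's, 'p) machine \<Rightarrow> 'e ltl \<Rightarrow> bool" where
  "satisfies M \<phi> \<longleftrightarrow> (\<forall>u. is_trace M u \<longrightarrow> sat \<phi> u)"

definition dependent_on :: "'e set \<Rightarrow> 'e ltl \<Rightarrow> bool" where
  "dependent_on \<beta> \<phi> \<longleftrightarrow>
     ltl_alphabet \<phi> \<subseteq> \<beta> \<and> (\<forall>u. sat \<phi> u \<longleftrightarrow> sat \<phi> (seq_restrict u \<beta>))"

end

theory Submission imports Defs begin

text \<open>
  An infinite run of \<open>M n\<close> is simulated in every machine \<open>M k\<close> of the chain by a run that stutters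
  at the events outside \<open>alphabet (M k)\<close>. If the run had only finitely many events in
  \<open>alphabet (M i)\<close>, then, going up the chain, eventually all its events in \<open>alphabet (M k)\<close> would
  be anticipated in \<open>M k\<close>: they are anticipated or convergent by the development strategy, and
  the variant allows only finitely many convergent ones. This is impossible for \<open>k = n\<close>. So the
  restriction of the run to \<open>alphabet (M i)\<close> is an infinite trace of \<open>M i\<close>, and it has the same
  restriction to \<open>\<beta>\<close> as the run itself.
\<close>

section \<open>Restriction of sequences\<close>

text \<open>An infinite set of naturals has only one increasing enumeration. Each of
  \<open>g n\<close> and \<open>enumerate S n\<close> is a value of the other enumeration. By the
  induction hypothesis and injectivity its index there is at least \<open>n\<close>, so each value
  is at most the other.\<close>

lemma strict_mono_eq_enumerate:
  fixes g :: "nat \<Rightarrow> nat"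
  assumes "strict_mono g" and "range g = S"
  shows "g = enumerate S"
proof (rule ext)
  have inf: "infinite S"
    using assms range_inj_infinite strict_mono_imp_inj_on by blast
  fix n
  show "g n = enumerate S n"
  proof (induction n rule: less_induct)
    case (less n)
    have "enumerate S n \<in> S"
      by (rule enumerate_in_set[OF inf])
    then obtain m where m: "enumerate S n = g m"
      using assms(2) by auto
    obtain l where l: "g n = enumerate S l"
      using inf assms(2) enumerate_Ex by (metis rangeI)
    have "\<not> m < n"
    proof
      assume "m < n"
      with less m have "enumerate S n = enumerate S m" by simp
      with \<open>m < n\<close> enumerate_mono[OF \<open>m < n\<close> inf] show False by simp
    qed
    moreover have "\<not> l < n"
    proof
      assume "l < n"
      with less l have "g n = g l" by simp
      with \<open>l < n\<close> assms(1) show False by (metis less_irrefl strict_monoD)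
    qed
    ultimately have "g n \<le> g m" "enumerate S n \<le> enumerate S l"
      using assms(1) inf by (simp_all add: strict_mono_less_eq not_less)
    with m l show ?case by simp
  qed
qed

lemma sorted_list_of_set_strict_mono_image:
  fixes f :: "'a :: linorder \<Rightarrow> 'b :: linorder"
  assumes "strict_mono f" and "finite A"
  shows "sorted_list_of_set (f ` A) = map f (sorted_list_of_set A)"
proof (rule strict_sorted_equal)
  show "sorted_wrt (<) (map f (sorted_list_of_set A))"
    unfolding sorted_wrt_map using assms(1)
    by (intro sorted_wrt_mono_rel[OF _ strict_sorted_list_of_set]) (auto dest: strict_monoD)
qed (use assms in auto)

text \<open>The enumeration \<open>g\<close> of the positions kept by \<open>A\<close> translates
  positions in the restricted sequence into positions in \<open>s\<close>. It maps \<open>R\<close>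
  increasingly onto \<open>Q\<close>, so it preserves finiteness, sorted lists and increasing
  enumerations.\<close>

lemma seq_restrict_seq_restrict_Inf:
  assumes "B \<subseteq> A" and inf: "infinite {k. s k \<in> A}"
  shows "seq_restrict (seq_restrict (Inf s) A) B = seq_restrict (Inf s) B"
proof -
  define P where "P = {k. s k \<in> A}"
  define g where "g = enumerate P"
  define Q where "Q = {k. s k \<in> B}"
  define R where "R = {j. s (g j) \<in> B}"
  have P: "infinite P" using inf P_def by simp
  have g: "strict_mono g" unfolding g_def by (rule strict_mono_enumerate[OF P])
  have "range g = P" unfolding g_def by (rule range_enumerate[OF P])
  moreover have "Q \<subseteq> P" using assms(1) by (auto simp: P_def Q_def)
  moreover have "R = g -` Q" by (auto simp: R_def Q_def)
  ultimately have Q: "Q = g ` R" by auto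
  have fin: "finite Q \<longleftrightarrow> finite R"
    unfolding Q by (rule finite_image_iff) (use g strict_mono_imp_inj_on inj_on_subset in blast)
  have l: "seq_restrict (seq_restrict (Inf s) A) B =
      (if finite R then Fin (map (s \<circ> g) (sorted_list_of_set R))
       else Inf (\<lambda>j. s (g (enumerate R j))))"
    using P by (simp add: P_def[symmetric] g_def[symmetric] R_def[symmetric] comp_def)
  have r: "seq_restrict (Inf s) B =
      (if finite Q then Fin (map s (sorted_list_of_set Q)) else Inf (\<lambda>j. s (enumerate Q j)))"
    by (simp add: Q_def[symmetric])
  show ?thesis
  proof (cases "finite R")
    case True
    then show ?thesis
      using sorted_list_of_set_strict_mono_image[OF g True] fin unfolding l r Q by simp
  next
    case False
    have "g \<circ> enumerate R = enumerate Q"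
    proof (rule strict_mono_eq_enumerate)
      show "strict_mono (g \<circ> enumerate R)"
        by (intro strict_mono_o g strict_mono_enumerate[OF False])
      show "range (g \<circ> enumerate R) = Q"
        unfolding image_comp[symmetric] range_enumerate[OF False] Q ..
    qed
    then have "enumerate Q j = g (enumerate R j)" for j
      by (metis comp_apply)
    with False fin show ?thesis unfolding l r by simp
  qed
qed

section \<open>Stuttering runs\<close>

text \<open>All machines run along the same unshortened sequence, so position \<open>j\<close> means
  the same event at every level. Facts that hold for all large \<open>j\<close> then pass along the
  chain without reindexing.\<close>

definition stuttering_run ::
  "('e, 's, 'p) machine \<Rightarrow> (nat \<Rightarrow> 'e) \<Rightarrow> (nat \<Rightarrow> 's) \<Rightarrow> bool" where
  "stuttering_run M s v \<longleftrightarrow> v 0 \<in> initial M \<and>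
     (\<forall>j. if s j \<in> alphabet M then step M (v j) (s j) (v (Suc j)) else v (Suc j) = v j)"

text \<open>Steps are assumed only below \<open>l\<close>, so that finite traces are covered as well
  as stuttering infinite runs.\<close>

lemma invariant_execution:
  assumes "event_b_machine M" and "v 0 \<in> initial M"
    and "\<And>k. k < l \<Longrightarrow> step M (v k) (s k) (v (Suc k)) \<or> v (Suc k) = v k"
  shows "v l \<in> states M \<and> invariant M (v l)"
  using assms(3)
proof (induction l)
  case 0
  then show ?case using assms(1,2) by (auto simp: event_b_machine_def)
next
  case (Suc l)
  then have IH: "v l \<in> states M \<and> invariant M (v l)" by auto
  from Suc.prems[of l] show ?case
  proof
    assume "step M (v l) (s l) (v (Suc l))"
    moreover from this have "v (Suc l) \<in> states M" by (simp add: step_def)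
    ultimately show ?thesis using IH assms(1) unfolding event_b_machine_def by blast
  qed (use IH in auto)
qed

lemma stuttering_run_invariant:
  assumes "event_b_machine M" and "stuttering_run M s v"
  shows "v j \<in> states M \<and> invariant M (v j)"
  using assms by (intro invariant_execution[where s = s])
    (auto simp: stuttering_run_def split: if_splits)

lemma stuttering_run_const:
  assumes "stuttering_run M s v" and "a \<le> b"
    and "\<And>j. a \<le> j \<Longrightarrow> j < b \<Longrightarrow> s j \<notin> alphabet M"
  shows "v b = v a"
  using assms(2,3)
proof (induction b rule: dec_induct)
  case (step b)
  then have "s b \<notin> alphabet M" by simp
  with assms(1) have "v (Suc b) = v b" by (auto simp: stuttering_run_def)
  with step show ?case by simp
qed simp

text \<open>Sampling the run at the positions in \<open>A\<close> loses nothing: before the first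
  such position, and between two consecutive ones, the state does not change.\<close>

lemma is_trace_seq_restrict_stuttering_run:
  assumes run: "stuttering_run M s v" and inf: "infinite {j. s j \<in> alphabet M}"
  shows "is_trace M (seq_restrict (Inf s) (alphabet M))"
proof -
  define A where "A = {j. s j \<in> alphabet M}"
  define w where "w k = v (enumerate A k)" for k
  have A: "infinite A" using inf A_def by simp
  have "w 0 = v 0" unfolding w_def
  proof (rule stuttering_run_const[OF run])
    fix j assume "j < enumerate A 0"
    then show "s j \<notin> alphabet M"
      using not_less_Least unfolding enumerate_0 by (auto simp: A_def)
  qed simp
  moreover have "step M (w k) (s (enumerate A k)) (w (Suc k))" for k
  proof -
    have "enumerate A k \<in> A" by (rule enumerate_in_set[OF A])
    then have "step M (w k) (s (enumerate A k)) (v (Suc (enumerate A k)))"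
      using run by (auto simp: w_def A_def stuttering_run_def)
    moreover have "w (Suc k) = v (Suc (enumerate A k))" unfolding w_def
    proof (rule stuttering_run_const[OF run])
      show "Suc (enumerate A k) \<le> enumerate A (Suc k)"
        using enumerate_step[OF A] by (simp add: Suc_leI)
      fix j assume "Suc (enumerate A k) \<le> j" "j < enumerate A (Suc k)"
      then show "s j \<notin> alphabet M"
        using not_less_Least[of j] unfolding enumerate_Suc''[OF A] by (force simp: A_def)
    qed
    ultimately show ?thesis by simp
  qed
  ultimately show ?thesis
    using run A by (auto simp: A_def[symmetric] stuttering_run_def intro!: exI[of _ w])
qed

section \<open>Refinement without renaming or splitting\<close>

text \<open>One link of the chain. On \<open>alphabet M'\<close>, \<open>r\<close> is the partial
  identity with domain \<open>alphabet M\<close>. Fixing \<open>J\<close> and \<open>V\<close> lets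
  all results below speak of the same variant.\<close>

locale event_preserving_refinement =
  fixes M :: "('e, 's, 'p) machine" and r :: "'e \<rightharpoonup> 'e" and M' :: "('e, 't, 'q) machine"
    and J :: "'s \<Rightarrow> 't \<Rightarrow> bool" and V :: "'t \<Rightarrow> nat"
  assumes machine: "event_b_machine M"
    and machine': "event_b_machine M'"
    and refinement: "refinement_with M r M' J V"
    and subset: "alphabet M \<subseteq> alphabet M'"
    and refines_self: "\<And>e. e \<in> alphabet M \<Longrightarrow> r e = Some e"
    and new: "\<And>e. e \<in> alphabet M' \<Longrightarrow> e \<notin> alphabet M \<Longrightarrow> r e = None"
begin

lemma simulate_initial: "w \<in> initial M' \<Longrightarrow> \<exists>v\<in>initial M. J v w"
  using refinement by (simp add: refinement_with_def)

lemma simulate_step: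
  assumes "step M' w e w'" and "v \<in> states M" "w \<in> states M'"
    and "invariant M v" "invariant M' w" "J v w"
  shows "e \<in> alphabet M \<Longrightarrow> \<exists>v'. step M v e v' \<and> J v' w'"
    and "e \<notin> alphabet M \<Longrightarrow> J v w'"
    and "label M' e = Convergent \<Longrightarrow> V w' < V w"
    and "label M' e = Anticipated \<Longrightarrow> V w' \<le> V w"
proof -
  have e: "e \<in> alphabet M'" using assms(1) by (simp add: step_def)
  have simulation:
    "(\<forall>e'. r e = Some e' \<longrightarrow> (\<exists>v'. step M v e' v' \<and> J v' w')) \<and> (r e = None \<longrightarrow> J v w')"
    and variant:
    "(label M' e = Convergent \<longrightarrow> V w' < V w) \<and> (label M' e = Anticipated \<longrightarrow> V w' \<le> V w)"
    using refinement[unfolded refinement_with_def, THEN conjunct2, THEN bspec, OF assms(2),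
        THEN bspec, OF assms(3), THEN bspec, OF e] assms(1,4-6)
    by metis+
  show "e \<in> alphabet M \<Longrightarrow> \<exists>v'. step M v e v' \<and> J v' w'"
    using simulation by (simp add: refines_self)
  show "e \<notin> alphabet M \<Longrightarrow> J v w'"
    using simulation by (simp add: new[OF e])
  show "label M' e = Convergent \<Longrightarrow> V w' < V w" "label M' e = Anticipated \<Longrightarrow> V w' \<le> V w"
    using variant by simp_all
qed

lemma simulate_stuttering_run:
  assumes run: "stuttering_run M' s w"
  obtains v where "stuttering_run M s v" and "\<And>j. J (v j) (w j)"
proof -
  note w = stuttering_run_invariant[OF machine' run]
  let ?linked = "\<lambda>j v. v \<in> states M \<and> invariant M v \<and> J v (w j)"
  let ?next = "\<lambda>j v v'. if s j \<in> alphabet M then step M v (s j) v' else v' = v"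
  \<comment> \<open>Abstract states are chosen one after the other, each depending on the previous
    choice. Dependent choice controls the first state only through the predicate \<open>P\<close>,
    hence the clause for \<open>j = 0\<close>.\<close>
  have "\<exists>v. \<forall>j. (?linked j (v j) \<and> (j = 0 \<longrightarrow> v j \<in> initial M)) \<and> ?next j (v j) (v (Suc j))"
  proof (rule dependent_nat_choice[where
        P = "\<lambda>j v. ?linked j v \<and> (j = 0 \<longrightarrow> v \<in> initial M)" and Q = ?next])
    have "w 0 \<in> initial M'" using run by (simp add: stuttering_run_def)
    then obtain v where "v \<in> initial M" "J v (w 0)" using simulate_initial by blast
    moreover from this have "v \<in> states M" "invariant M v"
      using machine by (auto simp: event_b_machine_def)
    ultimately show "\<exists>v. ?linked 0 v \<and> (0 = (0::nat) \<longrightarrow> v \<in> initial M)"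
      by blast
  next
    fix v j
    assume "?linked j v \<and> (j = 0 \<longrightarrow> v \<in> initial M)"
    then have v: "?linked j v" by simp
    have "\<exists>v'. ?linked (Suc j) v' \<and> ?next j v v'"
    proof (cases "s j \<in> alphabet M'")
      case False
      then have "w (Suc j) = w j" "s j \<notin> alphabet M"
        using run subset by (auto simp: stuttering_run_def)
      with v show ?thesis by simp
    next
      case True
      then have st: "step M' (w j) (s j) (w (Suc j))"
        using run by (auto simp: stuttering_run_def)
      show ?thesis
      proof (cases "s j \<in> alphabet M")
        case True
        then obtain v' where v': "step M v (s j) v'" "J v' (w (Suc j))"
          using simulate_step(1)[OF st] v w by blast
        moreover have "v' \<in> states M" using v' by (simp add: step_def)
        moreover have "invariant M v'"
          using v v' machine unfolding event_b_machine_def by blast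
        ultimately show ?thesis using True by auto
      next
        \<comment> \<open>A new event: the concrete state moves while the abstract one stutters, and
          \<open>J\<close> survives.\<close>
        case False
        then show ?thesis using simulate_step(2)[OF st] v w by auto
      qed
    qed
    then show "\<exists>v'. (?linked (Suc j) v' \<and> (Suc j = 0 \<longrightarrow> v' \<in> initial M)) \<and> ?next j v v'"
      by simp
  qed
  then obtain v where "\<And>j. ?linked j (v j)" "v 0 \<in> initial M" "\<And>j. ?next j (v j) (v (Suc j))"
    by blast
  then show ?thesis by (intro that[of v]) (auto simp: stuttering_run_def)
qed

text \<open>The variant conditions are only guaranteed at states linked to an abstract state
  satisfying the invariant; the simulating run supplies one at every position.\<close>

lemma variant_stuttering_run:
  assumes run: "stuttering_run M' s w"
  shows "s j \<notin> alphabet M' \<or> label M' (s j) = Anticipated \<Longrightarrow> V (w (Suc j)) \<le> V (w j)"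
    and "s j \<in> alphabet M' \<Longrightarrow> label M' (s j) = Convergent \<Longrightarrow> V (w (Suc j)) < V (w j)"
proof -
  obtain v where v: "stuttering_run M s v" and J: "\<And>j. J (v j) (w j)"
    using simulate_stuttering_run[OF run] by blast
  have st: "if s j \<in> alphabet M' then step M' (w j) (s j) (w (Suc j)) else w (Suc j) = w j"
    using run by (simp add: stuttering_run_def)
  note inv = stuttering_run_invariant[OF machine v, of j]
    stuttering_run_invariant[OF machine' run, of j]
  show "V (w (Suc j)) \<le> V (w j)" if "s j \<notin> alphabet M' \<or> label M' (s j) = Anticipated"
    using that st simulate_step(4)[of "w j" "s j" "w (Suc j)" "v j"] inv J
    by (auto split: if_splits)
  show "V (w (Suc j)) < V (w j)" if "s j \<in> alphabet M'" "label M' (s j) = Convergent"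
    using that st simulate_step(3)[of "w j" "s j" "w (Suc j)" "v j"] inv J by auto
qed

end

lemma event_preserving_refinementI:
  assumes "event_b_machine M" "event_b_machine M'" "refines_W M r M'"
    and "alphabet M \<subseteq> alphabet M'"
    and "\<And>e e'. e' \<in> alphabet M' \<Longrightarrow> e \<in> alphabet M \<Longrightarrow> r e' = Some e \<longleftrightarrow> e' = e"
  shows "\<exists>J V. event_preserving_refinement M r M' J V"
proof -
  obtain J V where R: "refinement_with M r M' J V"
    using assms(3) by (auto simp: refines_W_def)
  have "event_preserving_refinement M r M' J V"
  proof
    \<comment> \<open>A refined event would lie in \<open>alphabet M\<close> by
      \<open>refines_W\<close>, hence equal \<open>e\<close>, as there is no renaming; but
      \<open>e\<close> is outside \<open>alphabet M\<close>.\<close>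
    show "r e = None" if "e \<in> alphabet M'" "e \<notin> alphabet M" for e
      using assms(3,5) that by (cases "r e") (auto simp: refines_W_def)
  qed (use assms R in auto)
  then show ?thesis by blast
qed

text \<open>Once the sequence no longer increases, it attains its least remaining value at some
  \<open>a\<close> and can never leave it.\<close>

lemma eventually_nonincreasing_imp_eventually_const:
  fixes f :: "nat \<Rightarrow> nat"
  assumes "\<forall>\<^sub>F j in sequentially. f (Suc j) \<le> f j"
  shows "\<forall>\<^sub>F j in sequentially. f (Suc j) = f j"
proof -
  obtain N where N: "\<And>j. j \<ge> N \<Longrightarrow> f (Suc j) \<le> f j"
    using assms by (auto simp: eventually_sequentially)
  define m where "m = (LEAST x. x \<in> f ` {N..})"
  have "m \<in> f ` {N..}" unfolding m_def by (rule LeastI[of _ "f N"]) auto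
  then obtain a where a: "a \<ge> N" "f a = m" by auto
  have least: "m \<le> f j" if "j \<ge> N" for j
    unfolding m_def by (rule Least_le) (use that in auto)
  have const: "f j = m" if "j \<ge> a" for j
    using that
  proof (induction j rule: dec_induct)
    case (step j)
    then show ?case using N[of j] least[of "Suc j"] a by simp
  qed (rule a)
  show ?thesis
    unfolding eventually_sequentially using const by (intro exI[of _ a]) simp
qed

lemma (in event_preserving_refinement) eventually_anticipated:
  assumes run: "stuttering_run M' s w" and strategy: "strategy_step M r M'"
    and ev: "\<forall>\<^sub>F j in sequentially. s j \<in> alphabet M \<longrightarrow> label M (s j) = Anticipated"
  shows "\<forall>\<^sub>F j in sequentially. s j \<in> alphabet M' \<longrightarrow> label M' (s j) = Anticipated"
proof -
  \<comment> \<open>A late event of \<open>M'\<close> is either new or anticipated in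
    \<open>M\<close>; the strategy treats both cases alike.\<close>
  have ev': "\<forall>\<^sub>F j in sequentially. s j \<in> alphabet M' \<longrightarrow> label M' (s j) \<in> {Anticipated, Convergent}"
    using ev
  proof eventually_elim
    case (elim j)
    show ?case
      using elim strategy refines_self[of "s j"] new[of "s j"]
      unfolding strategy_step_def by blast
  qed
  then have "\<forall>\<^sub>F j in sequentially. V (w (Suc j)) \<le> V (w j)"
  proof eventually_elim
    case (elim j)
    then show ?case
      using variant_stuttering_run[OF run, of j] by (auto intro: less_imp_le)
  qed
  then have "\<forall>\<^sub>F j in sequentially. V (w (Suc j)) = V (w j)"
    by (rule eventually_nonincreasing_imp_eventually_const)
  \<comment> \<open>A convergent event would strictly decrease the variant, which is now
    constant.\<close>
  with ev' show ?thesis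
  proof eventually_elim
    case (elim j)
    then show ?case using variant_stuttering_run(2)[OF run, of j] by auto
  qed
qed

section \<open>Refinement chains\<close>

text \<open>A finite trace would end in a state that satisfies the invariant but enables no
  event.\<close>

lemma is_trace_deadlock_free:
  assumes "event_b_machine M" and "deadlock_free M" and "is_trace M u"
  obtains s v where "u = Inf s" and "\<And>j. s j \<in> alphabet M" and "stuttering_run M s v"
proof (cases u)
  case (Inf s)
  with assms(3) obtain v where v: "v 0 \<in> initial M" "\<And>k. step M (v k) (s k) (v (Suc k))"
    by auto
  then have "s k \<in> alphabet M" for k by (auto simp: step_def)
  with v show ?thesis by (intro that[OF Inf, of v]) (auto simp: stuttering_run_def)
next
  case (Fin es)
  with assms(3) obtain v where v: "v 0 \<in> initial M"
      "\<And>k. k < length es \<Longrightarrow> step M (v k) (es ! k) (v (Suc k))"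
    and stuck: "\<forall>e\<in>alphabet M. \<not> enabled M e (v (length es))"
    by auto
  have "v (length es) \<in> states M \<and> invariant M (v (length es))"
    by (rule invariant_execution[of M v "length es" "\<lambda>k. es ! k"]) (use assms(1) v in auto)
  with assms(2) stuck show ?thesis by (auto simp: deadlock_free_def)
qed

theorem lemma2:
  fixes M :: "nat \<Rightarrow> ('e, 's, 'p) machine"
    and r :: "nat \<Rightarrow> 'e \<rightharpoonup> 'e"
    and i n :: nat
    and \<phi> :: "'e ltl"
    and \<beta> :: "'e set"
  assumes "infinite (UNIV :: 'e set)"
    and "i < n"
    and "\<forall>k\<in>{i..n}. event_b_machine (M k)"
    and "refinement_chain i n M r"
    and "development_strategy i n M r"
    and "no_renaming_or_splitting i n M r"
    and "satisfies (M i) \<phi>"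
    and "deadlock_free (M n)"
    and "\<forall>e\<in>alphabet (M n). label (M n) e \<noteq> Anticipated"
    and "dependent_on \<beta> \<phi>"
    and "\<beta> \<subseteq> alphabet (M i)"
  shows "satisfies (M n) \<phi>"
  unfolding satisfies_def
proof (intro allI impI)
  fix u assume u: "is_trace (M n) u"
  have "event_b_machine (M n)" using assms(2,3) by simp
  then obtain s v where s: "u = Inf s" "\<And>j. s j \<in> alphabet (M n)"
    and v: "stuttering_run (M n) s v"
    using is_trace_deadlock_free[OF _ assms(8) u] by blast
  have link: "\<exists>J V. event_preserving_refinement (M k) (r k) (M (Suc k)) J V"
    if "k \<in> {i..<n}" for k
  proof (rule event_preserving_refinementI)
    show "event_b_machine (M k)" "event_b_machine (M (Suc k))"
      using assms(3) that by auto
    show "refines_W (M k) (r k) (M (Suc k))"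
      using assms(4) that by (simp add: refinement_chain_def)
    show "alphabet (M k) \<subseteq> alphabet (M (Suc k))"
      using assms(6) that by (simp add: no_renaming_or_splitting_def)
    show "r k e' = Some e \<longleftrightarrow> e' = e"
      if "e' \<in> alphabet (M (Suc k))" "e \<in> alphabet (M k)" for e e'
      using assms(6) \<open>k \<in> {i..<n}\<close> that unfolding no_renaming_or_splitting_def by blast
  qed
  have run: "\<exists>v. stuttering_run (M k) s v" if "i \<le> k" "k \<le> n" for k
    using that(2,1)
  \<comment> \<open>Simulation turns a run of \<open>M (Suc k)\<close> into one of
    \<open>M k\<close>, so the induction descends from \<open>n\<close>.\<close>
  proof (induction k rule: inc_induct)
    case (step k)
    then obtain w where w: "stuttering_run (M (Suc k)) s w" by auto
    from step link[of k] obtain J V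
      where "event_preserving_refinement (M k) (r k) (M (Suc k)) J V" by auto
    then show ?case
      using event_preserving_refinement.simulate_stuttering_run[OF _ w] by blast
  qed (use v in blast)
  have inf: "infinite {j. s j \<in> alphabet (M i)}"
  proof
    assume "finite {j. s j \<in> alphabet (M i)}"
    then have init: "\<forall>\<^sub>F j in sequentially. s j \<notin> alphabet (M i)"
      by (simp add: cofinite_eq_sequentially[symmetric] eventually_cofinite)
    have "\<forall>\<^sub>F j in sequentially. s j \<in> alphabet (M k) \<longrightarrow> label (M k) (s j) = Anticipated"
      if "i \<le> k" "k \<le> n" for k
      using that
    \<comment> \<open>Labels propagate upwards from \<open>i\<close>. The base case is vacuous: late
      events lie outside \<open>alphabet (M i)\<close>.\<close>
    proof (induction k rule: dec_induct)
      case base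
      show ?case using init by eventually_elim simp
    next
      case (step k)
      then obtain w where w: "stuttering_run (M (Suc k)) s w" using run[of "Suc k"] by auto
      from step link[of k] obtain J V
        where "event_preserving_refinement (M k) (r k) (M (Suc k)) J V" by auto
      moreover have "strategy_step (M k) (r k) (M (Suc k))"
        using assms(5) step by (simp add: development_strategy_def)
      ultimately show ?case
        using event_preserving_refinement.eventually_anticipated[OF _ w] step by simp
    qed
    from this[of n] assms(2) have
      "\<forall>\<^sub>F j in sequentially. s j \<in> alphabet (M n) \<longrightarrow> label (M n) (s j) = Anticipated" by simp
    then show False using s(2) assms(9) by (auto simp: eventually_sequentially)
  qed
  obtain w where "stuttering_run (M i) s w" using run[of i] assms(2) by auto
  then have "is_trace (M i) (seq_restrict u (alphabet (M i)))"
    unfolding s(1) using inf by (rule is_trace_seq_restrict_stuttering_run)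
  then have "sat \<phi> (seq_restrict u (alphabet (M i)))"
    using assms(7) by (simp add: satisfies_def)
  \<comment> \<open>Dependence on \<beta> is used twice, for the trace of \<open>M i\<close> and for
    \<open>u\<close>; both have the same restriction to \<beta>.\<close>
  then have "sat \<phi> (seq_restrict (seq_restrict u (alphabet (M i))) \<beta>)"
    using assms(10) unfolding dependent_on_def by blast
  then have "sat \<phi> (seq_restrict u \<beta>)"
    unfolding s(1) seq_restrict_seq_restrict_Inf[OF assms(11) inf] .
  then show "sat \<phi> u"
    using assms(10) unfolding dependent_on_def by blast
qed

end
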